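(* Let $T>0$. There exists a divergence-free velocity field $u\in C^\infty([0,T)\times\mathbb T^3)$ (with values in $\mathbb R^3$), with volume-preserving Lagrangian flow $X$ and $F(a,t)=\nabla_aX(a,t)$, such that $$\int_0^T\|S(u)(t)\|_{L^\infty}\,dt=+\infty,\qquad\text{while}\qquad\sup_{a\in\mathbb T^3}\int_0^T|S(u)(X(a,t),t)|\,dt<\infty.$$ Consequently, for every nonempty finite direction system $\mathcal D=\{d_1,\ldots,d_M\}\subset\mathbb S^2$, $$\sup_{a\in\mathbb T^3}\int_0^T\max_j\Bigl|\frac{d}{dt}\log|F(a,t)d_j|\Bigr|\,dt<\infty.$$ More precisely, for this $u$ and for every robust direction system $\mathcal D=\{d_1,\ldots,d_M\}\subset\mathbb S^2$, with $q_j(a,t)=\partial_t\log|F(a,t)d_j|$, $$\int_0^T\operatorname*{ess\,sup}_{a\in\mathbb T^3}\Bigl(\sum_jq_j(a,t)^2\Bigr)^{1/2}dt=\infty,\qquad\sup_{a\in\mathbb T^3}\int_0^T\Bigl(\sum_jq_j(a,t)^2\Bigr)^{1/2}dt<\infty.$$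
   Context: $\mathbb T^3=(\mathbb R/2\pi\mathbb Z)^3$. The field $u$ is not required to solve any fluid equation. The Lagrangian flow is $\partial_tX(a,t)=u(X(a,t),t)$, $X(a,0)=a$, for $0\le t<T$. $S(u)=\frac12(\nabla u+\nabla u^\top)$, with pointwise matrix absolute values taken in the Frobenius norm. One has $q_j(a,t)=\tau_j^\top S(u)(X(a,t),t)\tau_j$ with $\tau_j=Fd_j/|Fd_j|$. A finite system $\mathcal D\subset\mathbb S^2$ is robust if for every $G\in\mathrm{SL}(3,\mathbb R)$ the map $B\mapsto\bigl((Gd_j)^\top B(Gd_j)/|Gd_j|^2\bigr)_j$ is injective on trace-free real symmetric $3\times3$ matrices; equivalently, $\operatorname{span}\{d_jd_j^\top\}$ is the space of all real symmetric $3\times3$ matrices. *)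

theory Defs
  imports "HOL-Analysis.Analysis" "HOL-Probability.Essential_Supremum"
begin

text \<open>
  The torus \<open>(R / 2 pi Z)^3\<close> is represented by its universal cover: a field on the torus is a
  field on \<^typ>\<open>real^3\<close> that is \<open>2 pi\<close>-periodic in each coordinate, and a self-map of the torus
  is given by a lift that commutes with the translations by \<open>2 pi\<close> along each axis.
  Suprema over the torus are suprema over \<^typ>\<open>real^3\<close> of periodic functions;
  measure-theoretic notions use the fundamental cube.
\<close>

definition torus_periodic :: "(real^3 \<Rightarrow> 'b) \<Rightarrow> bool" where
  "torus_periodic f \<longleftrightarrow> (\<forall>x i. f (x + axis i (2 * pi)) = f x)"

definition torus_equivariant :: "(real^3 \<Rightarrow> real^3) \<Rightarrow> bool" where
  "torus_equivariant \<phi> \<longleftrightarrow> (\<forall>x i. \<phi> (x + axis i (2 * pi)) = \<phi> x + axis i (2 * pi))"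

definition torus_measure :: "(real^3) measure" where
  "torus_measure = restrict_space lborel {x. \<forall>i. 0 \<le> x $ i \<and> x $ i < 2 * pi}"

text \<open>
  Derivatives are taken within \<open>S\<close>, so that for \<open>S = [0,T) \<times> R^3\<close> smoothness holds up to
  and including the initial time (with one-sided time derivatives there); derivatives within
  such an \<open>S\<close> are unique.
\<close>

primrec Ck_on :: "nat \<Rightarrow> 'a::real_normed_vector set \<Rightarrow> ('a \<Rightarrow> 'b::real_normed_vector) \<Rightarrow> bool" where
  "Ck_on 0 S f \<longleftrightarrow> continuous_on S f"
| "Ck_on (Suc k) S f \<longleftrightarrow>
     (\<forall>x\<in>S. f differentiable (at x within S)) \<and>
     (\<forall>v. Ck_on k S (\<lambda>x. frechet_derivative f (at x within S) v))"

definition Cinf_on :: "'a::real_normed_vector set \<Rightarrow> ('a \<Rightarrow> 'b::real_normed_vector) \<Rightarrow> bool" where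
  "Cinf_on S f \<longleftrightarrow> (\<forall>k. Ck_on k S f)"

definition smooth_field_on_torus :: "real \<Rightarrow> (real \<Rightarrow> real^3 \<Rightarrow> real^3) \<Rightarrow> bool" where
  "smooth_field_on_torus T u \<longleftrightarrow>
     Cinf_on ({0..<T} \<times> UNIV) (\<lambda>(t, x). u t x) \<and> (\<forall>t\<in>{0..<T}. torus_periodic (u t))"

definition divergence :: "(real^3 \<Rightarrow> real^3) \<Rightarrow> real^3 \<Rightarrow> real" where
  "divergence v x = trace (jacobian v (at x))"

text \<open>The norm of \<^typ>\<open>real^3^3\<close> is the Frobenius norm.\<close>

definition strain :: "(real^3 \<Rightarrow> real^3) \<Rightarrow> real^3 \<Rightarrow> real^3^3" where
  "strain v x = (1/2) *\<^sub>R (jacobian v (at x) + transpose (jacobian v (at x)))"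

definition lagrangian_flow ::
  "real \<Rightarrow> (real \<Rightarrow> real^3 \<Rightarrow> real^3) \<Rightarrow> (real^3 \<Rightarrow> real \<Rightarrow> real^3) \<Rightarrow> bool" where
  "lagrangian_flow T u X \<longleftrightarrow>
     (\<forall>a. X a 0 = a) \<and>
     (\<forall>a. \<forall>t\<in>{0..<T}. (X a has_vector_derivative u t (X a t)) (at t within {0..<T})) \<and>
     (\<forall>t\<in>{0..<T}. torus_equivariant (\<lambda>a. X a t))"

text \<open>
  For a torus-equivariant bijection this is equivalent to preservation of the Haar
  measure by the induced map of the torus.
\<close>

definition volume_preserving :: "(real^3 \<Rightarrow> real^3) \<Rightarrow> bool" where
  "volume_preserving \<phi> \<longleftrightarrow> \<phi> \<in> borel_measurable borel \<and> distr lborel borel \<phi> = lborel"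

definition deformation_gradient :: "(real^3 \<Rightarrow> real \<Rightarrow> real^3) \<Rightarrow> real^3 \<Rightarrow> real \<Rightarrow> real^3^3" where
  "deformation_gradient X a t = jacobian (\<lambda>b. X b t) (at a)"

definition log_stretch :: "(real^3 \<Rightarrow> real \<Rightarrow> real^3) \<Rightarrow> real^3 \<Rightarrow> real^3 \<Rightarrow> real \<Rightarrow> real" where
  "log_stretch X d a t = ln (norm (deformation_gradient X a t *v d))"

text \<open>The time derivative is taken within \<open>[0,T)\<close>, hence one-sided at \<open>t = 0\<close>.\<close>

definition stretch_rate ::
  "real \<Rightarrow> (real^3 \<Rightarrow> real \<Rightarrow> real^3) \<Rightarrow> real^3 \<Rightarrow> real^3 \<Rightarrow> real \<Rightarrow> real" where
  "stretch_rate T X d a t = vector_derivative (log_stretch X d a) (at t within {0..<T})"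

definition direction_system :: "(real^3) set \<Rightarrow> bool" where
  "direction_system D \<longleftrightarrow> finite D \<and> D \<subseteq> sphere 0 1"

definition robust :: "(real^3) set \<Rightarrow> bool" where
  "robust D \<longleftrightarrow> direction_system D \<and>
     (\<forall>G :: real^3^3. det G = 1 \<longrightarrow>
        inj_on (\<lambda>B :: real^3^3. \<lambda>d\<in>D. ((G *v d) \<bullet> (B *v (G *v d))) / (norm (G *v d))\<^sup>2)
               {B. transpose B = B \<and> trace B = 0})"

end

theory Submission
  imports Defs
begin

text \<open>
  The field is the unidirectional shear \<open>u(t,x) = \<partial>\<^sub>t r(t,x\<^sub>1) e\<^sub>2\<close> with
  \<open>r(t,y) = ((sin y)\<^sup>2 + \<tau>\<^sup>2)\<close> to the power \<open>1/2\<close> and \<open>\<tau> = T - t\<close>. Particles keep their first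
  coordinate, and \<open>X(a,t) = a + (r(t,a\<^sub>1) - r(0,a\<^sub>1)) e\<^sub>2\<close>. The shear rate
  \<open>\<tau> sin y cos y / r\<^sup>3\<close> concentrates at distance \<open>\<tau>\<close> from the plane \<open>sin y = 0\<close>, where it has
  size \<open>1/\<tau>\<close>, so its supremum is not integrable in time; but along a particle it is
  \<open>sin y cos y\<close> times the time derivative of \<open>1/r\<close>, so its time integral is at most
  \<open>\<bar>sin y\<bar> / r \<le> 1\<close>. In particular the total shear of \<open>F\<close> stays in \<open>[-1,1]\<close>, and on this compact
  range robustness bounds the stretch rates below by a multiple of the shear rate.
\<close>

section \<open>Smoothness on a half-open time slab\<close>

text \<open>A derivative within \<open>S\<close> at a point of \<open>S\<close> sees only values on
  \<open>S\<close>, so agreement there passes to every order.\<close>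

lemma Ck_on_cong:
  assumes "\<And>x. x \<in> S \<Longrightarrow> f x = g x" "Ck_on k S f"
  shows "Ck_on k S g"
  using assms
proof (induction k arbitrary: f g)
  case 0
  then show ?case
    by (simp cong: continuous_on_cong)
next
  case (Suc k)
  have der: "(f has_derivative D) (at x within S) \<longleftrightarrow> (g has_derivative D) (at x within S)"
    if "x \<in> S" for x D
    using that Suc.prems(1) by (metis has_derivative_transform)
  then have fr: "frechet_derivative f (at x within S) = frechet_derivative g (at x within S)"
    if "x \<in> S" for x
    using that by (simp add: frechet_derivative_def)
  have "Ck_on k S (\<lambda>x. frechet_derivative g (at x within S) v)" for v
    by (rule Suc.IH[of "\<lambda>x. frechet_derivative f (at x within S) v"])
      (use fr Suc.prems(2) in auto)
  moreover have "\<forall>x\<in>S. g differentiable (at x within S)"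
    using Suc.prems(2) der by (auto simp: differentiable_def)
  ultimately show ?case
    by simp
qed

text \<open>Every point of the slab admits short positive steps inside it along each coordinate
  direction, and these determine a linear map. At time 0 only forward steps remain, which
  suffices.\<close>

lemma slab_has_derivative_unique:
  fixes f :: "real \<times> 'a::euclidean_space \<Rightarrow> 'b::real_normed_vector"
  assumes "p \<in> {0..<T} \<times> UNIV"
    and "(f has_derivative D) (at p within {0..<T} \<times> UNIV)"
    and "(f has_derivative E) (at p within {0..<T} \<times> UNIV)"
  shows "D = E"
proof (rule frechet_derivative_unique_within[OF assms(2,3)])
  fix i :: "real \<times> 'a" and e :: real
  assume i: "i \<in> Basis" and e: "e > 0"
  obtain t x where p: "p = (t, x)" "0 \<le> t" "t < T"
    using assms(1) by auto
  \<comment> \<open>The first bound gives \<open>d < e\<close>; the second keeps a step in time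
    below \<open>T\<close>.\<close>
  define d where "d = min (e / 2) ((T - t) / 2)"
  have "0 < d" "d < e" "t + d < T"
    using e p by (auto simp: d_def min_def field_simps)
  moreover have "p + d *\<^sub>R i \<in> {0..<T} \<times> UNIV"
    using i p \<open>0 < d\<close> \<open>t + d < T\<close> by (auto simp: Basis_prod_def)
  ultimately show "\<exists>d. 0 < \<bar>d\<bar> \<and> \<bar>d\<bar> < e \<and> p + d *\<^sub>R i \<in> {0..<T} \<times> UNIV"
    by (intro exI[of _ d]) auto
qed

text \<open>Reduces smoothness to finding a class of functions closed under directional derivatives.
  Uniqueness on the slab identifies the derivative supplied by the class with the chosen
  \<open>frechet_derivative\<close>, so the induction on the order stays inside the class.\<close>

lemma Cinf_on_slabI:
  fixes f :: "real \<times> 'a::euclidean_space \<Rightarrow> 'b::real_normed_vector" and T :: real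
  defines "S \<equiv> {0..<T} \<times> (UNIV :: 'a set)"
  assumes closed: "\<And>f. f \<in> \<A> \<Longrightarrow>
      \<exists>D. (\<forall>p\<in>S. (f has_derivative D p) (at p within S)) \<and> (\<forall>v. (\<lambda>p. D p v) \<in> \<A>)"
    and "f \<in> \<A>"
  shows "Cinf_on S f"
  unfolding Cinf_on_def
proof
  fix k show "Ck_on k S f"
    using \<open>f \<in> \<A>\<close>
  proof (induction k arbitrary: f)
    case 0
    then obtain D where "\<forall>p\<in>S. (f has_derivative D p) (at p within S)"
      using closed by blast
    then show ?case
      by (auto intro: has_derivative_continuous_on)
  next
    case (Suc k)
    then obtain D where D: "\<forall>p\<in>S. (f has_derivative D p) (at p within S)"
      and D_in: "\<And>v. (\<lambda>p. D p v) \<in> \<A>"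
      using closed by blast
    have "D p = frechet_derivative f (at p within S)" if "p \<in> S" for p
    proof (rule slab_has_derivative_unique)
      show "p \<in> {0..<T} \<times> UNIV" using that by (simp add: S_def)
      show "(f has_derivative D p) (at p within {0..<T} \<times> UNIV)"
        using D that unfolding S_def by blast
      show "(f has_derivative frechet_derivative f (at p within S)) (at p within {0..<T} \<times> UNIV)"
        using D that unfolding S_def
        by (metis differentiableI frechet_derivative_works)
    qed
    then have "Ck_on k S (\<lambda>p. frechet_derivative f (at p within S) v)" for v
      using Ck_on_cong[OF _ Suc.IH[OF D_in[of v]]] by simp
    with D show ?case
      by (auto simp: differentiable_def)
  qed
qed

section \<open>Volume preservation and essential suprema\<close>

text \<open>Boxes determine Lebesgue measure. The preimage of a box under \<open>\<phi>\<close> is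
  its image under \<open>\<psi>\<close>, which the change of variables formula measures; hence the
  derivative is assumed of \<open>\<psi>\<close>.\<close>

lemma volume_preserving_unit_jacobian:
  fixes \<phi> \<psi> :: "real^'n::{finite,wellorder} \<Rightarrow> real^'n::_"
  assumes meas: "\<phi> \<in> borel_measurable borel"
    and inv: "\<And>x. \<psi> (\<phi> x) = x" "\<And>x. \<phi> (\<psi> x) = x"
    and der: "\<And>x. (\<psi> has_derivative D x) (at x)"
    and det: "\<And>x. \<bar>det (matrix (D x))\<bar> = 1"
  shows "distr lborel borel \<phi> = lborel"
proof (rule sym, rule lborel_eqI)
  fix l u :: "real^'n::_"
  assume lu: "\<And>b. b \<in> Basis \<Longrightarrow> l \<bullet> b \<le> u \<bullet> b"
  let ?B = "box l u"
  have B: "?B \<in> lmeasurable" by simp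
  have pre: "\<phi> -` ?B = \<psi> ` ?B"
  proof safe
    fix x assume "\<phi> x \<in> ?B"
    then show "x \<in> \<psi> ` ?B" using inv(1)[of x] by (metis imageI)
  qed (simp add: inv)
  have "\<psi> ` ?B \<in> lmeasurable \<and> measure lebesgue (\<psi> ` ?B) = measure lebesgue ?B"
  proof (subst has_measure_differentiable_image)
    show "(\<psi> has_derivative D x) (at x within ?B)" for x
      using der by (rule has_derivative_at_withinI)
    show "inj_on \<psi> ?B"
      by (metis inj_onI inv(2))
    show "((\<lambda>x. \<bar>det (matrix (D x))\<bar>) has_integral measure lebesgue ?B) ?B"
      unfolding det lmeasure_integral[OF B]
      by (rule integrable_integral[OF integrable_on_const[OF B]])
  qed simp
  then have "emeasure lebesgue (\<psi> ` ?B) = emeasure lebesgue ?B"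
    using B by (simp add: emeasure_eq_measure2)
  \<comment> \<open>On Borel sets the completed measure agrees with \<open>lborel\<close>.\<close>
  moreover have "\<phi> -` ?B \<in> sets borel"
    using measurable_sets[OF meas, of ?B] by simp
  ultimately have "emeasure lborel (\<phi> -` ?B) = emeasure lborel ?B"
    by (simp add: pre)
  then show "emeasure (distr lborel borel \<phi>) ?B = (\<Prod>b\<in>Basis. (u - l) \<bullet> b)"
    using lu meas by (simp add: emeasure_distr)
qed simp

text \<open>If the essential supremum were below \<open>h x0\<close>, continuity would keep it below
  \<open>h\<close> on a neighbourhood of \<open>x0\<close>, and a nonempty open set is not
  null.\<close>

lemma esssup_torus_ge:
  fixes f :: "real^3 \<Rightarrow> ennreal" and h :: "real^3 \<Rightarrow> real"
  assumes le: "\<And>x. ennreal (h x) \<le> f x" and cont: "continuous (at x0) h"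
    and x0: "\<And>i. 0 < x0 $ i \<and> x0 $ i < 2 * pi"
  shows "ennreal (h x0) \<le> esssup torus_measure f"
proof (rule ccontr)
  assume "\<not> ennreal (h x0) \<le> esssup torus_measure f"
  then have less: "esssup torus_measure f < ennreal (h x0)" by simp
  define C where "C = {x :: real^3. \<forall>i. 0 \<le> x $ i \<and> x $ i < 2 * pi}"
  \<comment> \<open>An open box inside the half-open cube \<open>C\<close>, so that
    \<open>U \<inter> Q\<close> is open and the almost-everywhere bound on \<open>C\<close> applies
    to it.\<close>
  define Q where "Q = box (0 :: real^3) (\<chi> i. 2 * pi)"
  have Q: "open Q" "x \<in> Q \<longleftrightarrow> (\<forall>i. 0 < x $ i \<and> x $ i < 2 * pi)" for x
    unfolding Q_def by (simp_all add: open_box mem_box_cart)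
  have "((\<lambda>x. ennreal (h x)) \<longlongrightarrow> ennreal (h x0)) (at x0)"
    using cont by (intro tendsto_ennrealI) (simp add: continuous_within)
  then have "\<forall>\<^sub>F x in at x0. esssup torus_measure f < ennreal (h x)"
    using less by (rule order_tendstoD)
  then obtain U where "open U" "x0 \<in> U"
      and "\<forall>x\<in>U. x \<noteq> x0 \<longrightarrow> esssup torus_measure f < ennreal (h x)"
    unfolding eventually_at_topological by blast
  with less have U: "open U" "x0 \<in> U"
      "\<And>x. x \<in> U \<Longrightarrow> esssup torus_measure f < ennreal (h x)"
    by metis+
  \<comment> \<open>This covers nonmeasurable \<open>f\<close> too, whose essential supremum is top
    by convention.\<close>
  have "AE x in torus_measure. f x \<le> esssup torus_measure f"
    by (rule esssup_AE)
  moreover have "torus_measure = restrict_space lborel C" and C: "C \<inter> space lborel \<in> sets lborel"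
    unfolding C_def torus_measure_def by (simp, measurable)
  ultimately have "AE x in restrict_space lborel C. f x \<le> esssup torus_measure f"
    by metis
  then have "AE x in lborel. x \<in> C \<longrightarrow> f x \<le> esssup torus_measure f"
    by (simp only: AE_restrict_space_iff[OF C])
  then have "AE x in lborel. x \<notin> U \<inter> Q"
  proof (rule eventually_mono, intro notI)
    fix x
    assume a: "x \<in> C \<longrightarrow> f x \<le> esssup torus_measure f" and x: "x \<in> U \<inter> Q"
    then have "x \<in> C"
      by (auto simp: Q(2) C_def less_imp_le)
    then have "ennreal (h x) \<le> esssup torus_measure f"
      using a le[of x] by (meson order_trans)
    then show False
      using U(3)[of x] x by (simp add: leD)
  qed
  moreover have "open (U \<inter> Q)" using U Q(1) by blast
  ultimately have "U \<inter> Q \<in> null_sets lborel"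
    by (simp add: AE_iff_null_sets borel_open)
  then have "U \<inter> Q \<in> null_sets lebesgue"
    by (simp add: null_sets_completionI)
  then have "U \<inter> Q = {}"
    using \<open>open (U \<inter> Q)\<close> by (metis negligible_iff_null_sets open_not_negligible)
  then show False
    using U x0 by (auto simp: Q(2))
qed

text \<open>The antiderivative \<open>- c * ln (T - t)\<close> is unbounded at \<open>T\<close>, so
  intervals ending before \<open>T\<close> already contribute any prescribed amount.\<close>

lemma nn_integral_inverse_distance_endpoint:
  fixes f :: "real \<Rightarrow> ennreal"
  assumes "c > 0" "0 \<le> s" "s < T"
    and f: "\<And>t. s \<le> t \<Longrightarrow> t < T \<Longrightarrow> ennreal (c / (T - t)) \<le> f t"
  shows "(\<integral>\<^sup>+t\<in>{0..<T}. f t \<partial>lborel) = \<infinity>"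
proof -
  have "ennreal (real n) \<le> (\<integral>\<^sup>+t\<in>{0..<T}. f t \<partial>lborel)" for n :: nat
  proof -
    \<comment> \<open>Solves \<open>c * ln ((T - s) / (T - b)) = n\<close>, so the minorant
      integrates to exactly \<open>n\<close> over \<open>{s..b}\<close>.\<close>
    define b where "b = T - (T - s) * exp (- real n / c)"
    have "exp (- real n / c) \<le> 1" using \<open>c > 0\<close> by simp
    then have "(T - s) * exp (- real n / c) \<le> (T - s) * 1"
      using \<open>s < T\<close> by (intro mult_left_mono) auto
    then have b: "s \<le> b" "b < T"
      using \<open>s < T\<close> by (auto simp: b_def algebra_simps)
    have Tb: "ln (T - b) = ln (T - s) - real n / c"
      using \<open>s < T\<close> by (simp add: b_def ln_mult)
    have "(\<integral>\<^sup>+t. ennreal (c / (T - t)) * indicator {s..b} t \<partial>lborel)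
        = ennreal (- c * ln (T - b) - (- c * ln (T - s)))"
      using b \<open>c > 0\<close>
      by (intro nn_integral_FTC_Icc) (auto intro!: derivative_eq_intros)
    also have "- c * ln (T - b) - (- c * ln (T - s)) = real n"
      using \<open>c > 0\<close> by (simp add: Tb field_simps)
    finally have "ennreal (real n) = (\<integral>\<^sup>+t. ennreal (c / (T - t)) * indicator {s..b} t \<partial>lborel)"
      by simp
    also have "\<dots> \<le> (\<integral>\<^sup>+t\<in>{0..<T}. f t \<partial>lborel)"
      using b \<open>0 \<le> s\<close> f by (intro nn_integral_mono) (auto split: split_indicator)
    finally show ?thesis .
  qed
  then have "of_nat n \<le> (\<integral>\<^sup>+t\<in>{0..<T}. f t \<partial>lborel)" for n :: nat
    by (simp add: ennreal_of_nat_eq_real_of_nat)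
  then show ?thesis
    using ennreal_Ex_less_of_nat[of "\<integral>\<^sup>+t\<in>{0..<T}. f t \<partial>lborel"]
    by (metis infinity_ennreal_def leD less_top)
qed

section \<open>Shears along the second axis\<close>

definition shear_gradient :: "real \<Rightarrow> real^3^3" where
  "shear_gradient c = (\<chi> i j. if i = 2 \<and> j = 1 then c else 0)"

lemma has_derivative_shear_profile:
  assumes "(h has_real_derivative c) (at (x $ 1))"
  shows "((\<lambda>y :: real^3. h (y $ 1) *\<^sub>R axis 2 1 :: real^3) has_derivative
    (\<lambda>v. (c * v $ 1) *\<^sub>R axis 2 1)) (at x)"
proof -
  have "((\<lambda>y :: real^3. h (y $ 1)) has_derivative (\<lambda>v. c * v $ 1)) (at x)"
    using assms
    by (intro has_derivative_compose[of "\<lambda>y. y $ 1" "\<lambda>v. v $ 1" x UNIV h "\<lambda>v. c * v"])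
      (auto simp: has_field_derivative_def intro!: bounded_linear_imp_has_derivative bounded_linear_vec_nth)
  then show ?thesis
    by (rule has_derivative_scaleR_left)
qed

lemma matrix_shear_profile:
  "matrix (\<lambda>v :: real^3. (c * v $ 1) *\<^sub>R axis 2 (1 :: real)) = shear_gradient c"
  by (simp add: vec_eq_iff forall_3 matrix_def shear_gradient_def axis_def)

lemma matrix_shear:
  "matrix (\<lambda>v. v + (c * v $ 1) *\<^sub>R axis 2 (1 :: real)) = mat 1 + shear_gradient c"
  by (simp add: vec_eq_iff forall_3 matrix_def shear_gradient_def axis_def mat_def)

lemma det_shear: "det (mat 1 + shear_gradient c) = 1"
  by (simp add: det_3 mat_def shear_gradient_def)

lemma jacobian_shear_profile:
  assumes "(h has_real_derivative c) (at (x $ 1))"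
  shows "jacobian (\<lambda>y :: real^3. h (y $ 1) *\<^sub>R axis 2 1) (at x) = shear_gradient c"
  using frechet_derivative_at[OF has_derivative_shear_profile[OF assms]]
  by (simp add: jacobian_def flip: matrix_shear_profile)

lemma has_derivative_shear:
  assumes "(h has_real_derivative c) (at (x $ 1))"
  shows "((\<lambda>y :: real^3. y + h (y $ 1) *\<^sub>R axis 2 1) has_derivative
    (\<lambda>v. v + (c * v $ 1) *\<^sub>R axis 2 (1 :: real))) (at x)"
  by (intro has_derivative_add has_derivative_ident has_derivative_shear_profile assms)

lemma jacobian_shear:
  assumes "(h has_real_derivative c) (at (x $ 1))"
  shows "jacobian (\<lambda>y :: real^3. y + h (y $ 1) *\<^sub>R axis 2 1) (at x) = mat 1 + shear_gradient c"
  using frechet_derivative_at[OF has_derivative_shear[OF assms]]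
  by (simp add: jacobian_def flip: matrix_shear)

text \<open>A shear fixes the first coordinate on which its profile depends, so the shear by
  \<open>- h\<close> inverts it; the derivative of that inverse is unipotent.\<close>

lemma volume_preserving_shear:
  assumes h: "\<And>y. (h has_real_derivative h' y) (at y)"
  shows "volume_preserving (\<lambda>x :: real^3. x + h (x $ 1) *\<^sub>R axis 2 1)"
  unfolding volume_preserving_def
proof
  let ?\<phi> = "\<lambda>x :: real^3. x + h (x $ 1) *\<^sub>R axis 2 1"
  let ?\<psi> = "\<lambda>x :: real^3. x + (- h (x $ 1)) *\<^sub>R axis 2 1"
  have "continuous_on UNIV ?\<phi>"
    by (intro continuous_at_imp_continuous_on ballI has_derivative_continuous[OF has_derivative_shear[OF h]])
  then show meas: "?\<phi> \<in> borel_measurable borel"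
    by (rule borel_measurable_continuous_onI)
  show "distr lborel borel ?\<phi> = lborel"
  proof (rule volume_preserving_unit_jacobian[OF meas])
    show "?\<psi> (?\<phi> x) = x" "?\<phi> (?\<psi> x) = x" for x
      by (simp_all add: axis_def)
    show "(?\<psi> has_derivative (\<lambda>v. v + (- h' (x $ 1) * v $ 1) *\<^sub>R axis 2 1)) (at x)" for x
      by (intro has_derivative_shear DERIV_minus h)
    show "\<bar>det (matrix (\<lambda>v :: real^3. v + (- h' (x $ 1) * v $ 1) *\<^sub>R axis 2 (1 :: real)))\<bar> = 1" for x :: "real^3"
      by (simp only: matrix_shear det_shear abs_one)
  qed
qed

lemma torus_equivariant_shear:
  assumes "\<And>y. h (y + 2 * pi) = h y"
  shows "torus_equivariant (\<lambda>x :: real^3. x + h (x $ 1) *\<^sub>R axis 2 1)"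
  unfolding torus_equivariant_def
proof (intro allI)
  fix x :: "real^3" and i :: 3
  have "h ((x + axis i (2 * pi)) $ 1) = h (x $ 1)"
    using assms by (cases "i = 1") (auto simp: axis_def)
  then show "x + axis i (2 * pi) + h ((x + axis i (2 * pi)) $ 1) *\<^sub>R axis 2 1 =
      x + h (x $ 1) *\<^sub>R axis 2 1 + axis i (2 * pi)"
    by simp
qed

text \<open>The strain has two nonzero entries at most, both \<open>c / 2\<close>, so its norm is
  \<open>\<bar>c\<bar> / sqrt 2\<close>; the stated bounds avoid the root.\<close>

lemma shear_strain_bounds:
  assumes "(h has_real_derivative c) (at (x $ 1))"
  defines "v \<equiv> \<lambda>y :: real^3. h (y $ 1) *\<^sub>R axis 2 1"
  shows "\<bar>c\<bar> / 2 \<le> norm (strain v x)" "norm (strain v x) \<le> \<bar>c\<bar>"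
proof -
  have s: "strain v x = (\<chi> i j. if i = 2 \<and> j = 1 \<or> i = 1 \<and> j = 2 then c / 2 else 0)"
    using jacobian_shear_profile[OF assms(1)]
    by (simp add: strain_def v_def vec_eq_iff forall_3 shear_gradient_def transpose_def)
  have "\<bar>c\<bar> / 2 = \<bar>strain v x $ 2 $ 1\<bar>"
    by (simp add: s)
  also have "\<dots> \<le> norm (strain v x)"
    by (rule order_trans[OF component_le_norm_cart Finite_Cartesian_Product.norm_nth_le])
  finally show "\<bar>c\<bar> / 2 \<le> norm (strain v x)" .
  have "norm (strain v x) \<le> (\<Sum>i\<in>UNIV. norm (strain v x $ i))"
    unfolding norm_vec_def by (rule L2_set_le_sum) simp
  also have "\<dots> \<le> (\<Sum>i\<in>UNIV. \<Sum>j\<in>UNIV. \<bar>strain v x $ i $ j\<bar>)"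
    by (intro sum_mono norm_le_l1_cart)
  also have "\<dots> = \<bar>c\<bar>"
    by (simp add: s sum_3)
  finally show "norm (strain v x) \<le> \<bar>c\<bar>" .
qed

lemma divergence_shear:
  assumes "(h has_real_derivative c) (at (x $ 1))"
  shows "divergence (\<lambda>y. h (y $ 1) *\<^sub>R axis 2 1) x = 0"
  using jacobian_shear_profile[OF assms]
  by (simp add: divergence_def trace_def sum_3 shear_gradient_def)

text \<open>The logarithmic derivative of \<open>|(1 + p E) d|\<close> with respect to \<open>p\<close>, where \<open>E\<close> is the
  matrix unit in position \<open>(2, 1)\<close>.\<close>

definition stretch_factor :: "real^3 \<Rightarrow> real \<Rightarrow> real" where
  "stretch_factor d p = d $ 1 * (d $ 2 + p * d $ 1) / (norm ((mat 1 + shear_gradient p) *v d))\<^sup>2"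

lemma shear_mult:
  "((mat 1 + shear_gradient p) *v d) = d + (p * d $ 1) *\<^sub>R axis 2 1"
  by (simp add: vec_eq_iff forall_3 matrix_vector_mult_def sum_3 shear_gradient_def axis_def mat_def)

lemma norm_shear_mult:
  "(norm ((mat 1 + shear_gradient p) *v d))\<^sup>2 = (d $ 1)\<^sup>2 + (d $ 2 + p * d $ 1)\<^sup>2 + (d $ 3)\<^sup>2"
  unfolding power2_norm_eq_inner
  by (simp add: shear_mult inner_vec_def sum_3 axis_def power2_eq_square)

lemma shear_mult_nonzero:
  assumes "d \<noteq> 0"
  shows "(mat 1 + shear_gradient p) *v d \<noteq> 0"
  using assms by (auto simp: shear_mult vec_eq_iff forall_3 axis_def)

text \<open>By the arithmetic-geometric mean inequality, twice the numerator is at most the sum of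
  two of the three squares in the denominator. For \<open>d = 0\<close> the quotient is 0.\<close>

lemma abs_stretch_factor_le:
  "\<bar>stretch_factor d p\<bar> \<le> 1"
proof (cases "d = 0")
  case False
  have "2 * \<bar>d $ 1 * (d $ 2 + p * d $ 1)\<bar> \<le> (d $ 1)\<^sup>2 + (d $ 2 + p * d $ 1)\<^sup>2"
    using sum_squares_bound[of "\<bar>d $ 1\<bar>" "\<bar>d $ 2 + p * d $ 1\<bar>"] by (simp add: abs_mult)
  also have "\<dots> \<le> (norm ((mat 1 + shear_gradient p) *v d))\<^sup>2"
    by (simp add: norm_shear_mult)
  finally show ?thesis
    using shear_mult_nonzero[OF False, of p] by (simp add: stretch_factor_def)
qed (simp add: stretch_factor_def)

lemma has_derivative_log_norm_shear:
  assumes p: "(p has_real_derivative p') (at t within S)" and "d \<noteq> 0"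
  shows "((\<lambda>t. ln (norm ((mat 1 + shear_gradient (p t)) *v d))) has_real_derivative
    p' * stretch_factor d (p t)) (at t within S)"
proof -
  \<comment> \<open>The logarithm of the norm is differentiated as half the logarithm of this
    positive polynomial in \<open>p t\<close>.\<close>
  define N where "N = (\<lambda>t. (d $ 1)\<^sup>2 + (d $ 2 + p t * d $ 1)\<^sup>2 + (d $ 3)\<^sup>2)"
  have N: "N t = (norm ((mat 1 + shear_gradient (p t)) *v d))\<^sup>2" for t
    by (simp add: N_def norm_shear_mult)
  have pos: "N t > 0" for t
    using shear_mult_nonzero[OF assms(2)] by (simp add: N)
  have "((\<lambda>t. ln (N t) / 2) has_real_derivative p' * stretch_factor d (p t)) (at t within S)"
    unfolding stretch_factor_def N[symmetric]
    using pos[of t] unfolding N_def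
    by (auto intro!: derivative_eq_intros p simp: field_simps)
  moreover have "ln (N t) / 2 = ln (norm ((mat 1 + shear_gradient (p t)) *v d))" for t
    using shear_mult_nonzero[OF assms(2), of "p t"] by (simp add: N ln_realpow)
  ultimately show ?thesis by simp
qed

text \<open>Robustness is tested against the strain of a unit shear, which no \<open>G\<close> of determinant one
  may annihilate; compactness makes the bound uniform over shears of bounded size.\<close>

lemma robust_stretch_factor_bound:
  assumes "robust D"
  shows "\<exists>c>0. \<forall>p\<in>{-1..1}. c \<le> (\<Sum>d\<in>D. (stretch_factor d p)\<^sup>2)"
proof -
  have D: "finite D" "\<And>d. d \<in> D \<Longrightarrow> d \<noteq> 0"
    using assms by (auto simp: robust_def direction_system_def)
  define \<Phi> where "\<Phi> p = (\<Sum>d\<in>D. (stretch_factor d p)\<^sup>2)" for p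
  \<comment> \<open>Twice the strain of the unit shear. Its quadratic form at a sheared direction is
    twice the numerator of \<open>stretch_factor\<close>, so if all factors vanished at
    \<open>p\<close>, robustness for the shear by \<open>p\<close> could not separate
    \<open>B\<close> from 0.\<close>
  define B :: "real^3^3" where "B = shear_gradient 1 + transpose (shear_gradient 1)"
  have B: "transpose B = B" "trace B = 0" "B \<noteq> 0"
    by (simp_all add: B_def vec_eq_iff forall_3 transpose_def shear_gradient_def trace_def sum_3)
  have quad: "y \<bullet> (B *v y) = 2 * y $ 1 * y $ 2" for y :: "real^3"
    by (simp add: B_def inner_vec_def sum_3 matrix_vector_mult_def shear_gradient_def transpose_def)
  have pos: "\<Phi> p > 0" for p
  proof (rule ccontr)
    assume "\<not> \<Phi> p > 0"
    then have "\<Phi> p = 0"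
      unfolding \<Phi>_def by (meson antisym_conv2 not_less sum_nonneg zero_le_power2)
    then have zero: "stretch_factor d p = 0" if "d \<in> D" for d
      using that D(1) by (simp add: \<Phi>_def sum_nonneg_eq_0_iff)
    define G where "G = mat 1 + shear_gradient p"
    have "(G *v d) \<bullet> (B *v (G *v d)) = 0" if "d \<in> D" for d
    proof -
      have "(G *v d) $ 1 * (G *v d) $ 2 = d $ 1 * (d $ 2 + p * d $ 1)"
        by (simp add: G_def shear_mult axis_def)
      also have "\<dots> = 0"
        using zero[OF that] shear_mult_nonzero[OF D(2)[OF that], of p]
        by (simp add: stretch_factor_def)
      finally show ?thesis by (simp add: quad)
    qed
    moreover have "inj_on (\<lambda>B :: real^3^3. \<lambda>d\<in>D. ((G *v d) \<bullet> (B *v (G *v d))) / (norm (G *v d))\<^sup>2)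
               {B. transpose B = B \<and> trace B = 0}"
      using assms det_shear by (simp add: robust_def G_def)
    moreover have "(0 :: real^3^3) \<in> {B. transpose B = B \<and> trace B = 0}"
      by (simp add: transpose_def vec_eq_iff trace_def)
    ultimately have "B = 0"
      using B(1,2) by (auto dest!: inj_onD[of _ _ B 0] cong: restrict_cong)
    with B(3) show False by simp
  qed
  have "continuous_on {-1..1} \<Phi>"
    unfolding \<Phi>_def stretch_factor_def shear_mult
    by (intro continuous_intros)
      (use shear_mult_nonzero[OF D(2)] in \<open>auto simp: shear_mult\<close>)
  then obtain p where "\<forall>q\<in>{-1..1}. \<Phi> p \<le> \<Phi> q"
    using continuous_attains_inf[of "{-1..1::real}" \<Phi>] by auto
  with pos[of p] show ?thesis
    unfolding \<Phi>_def by blast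
qed

section \<open>The concentrating shear\<close>

definition radius :: "real \<Rightarrow> real \<Rightarrow> real" where
  "radius \<tau> y = sqrt ((sin y)\<^sup>2 + \<tau>\<^sup>2)"

definition shear_rate :: "real \<Rightarrow> real \<Rightarrow> real" where
  "shear_rate \<tau> y = \<tau> * sin y * cos y / radius \<tau> y ^ 3"

text \<open>The space derivative of the displacement \<open>radius (T - t) y - radius T y\<close>,
  hence the off-diagonal entry of the deformation gradient; its time derivative is
  \<open>shear_rate (T - t) y\<close>.\<close>

definition shear_strength :: "real \<Rightarrow> real \<Rightarrow> real \<Rightarrow> real" where
  "shear_strength T t y = sin y * cos y * (1 / radius (T - t) y - 1 / radius T y)"

lemma radius_pos: "0 < radius \<tau> y" if "\<tau> \<noteq> 0 \<or> sin y \<noteq> 0"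
  using that by (auto simp: radius_def add_pos_nonneg add_nonneg_pos)

lemma abs_sin_le_radius: "\<bar>sin y\<bar> \<le> radius \<tau> y"
  unfolding radius_def by (rule real_le_rsqrt) simp

lemma radius_mono: "0 \<le> \<sigma> \<Longrightarrow> \<sigma> \<le> \<tau> \<Longrightarrow> radius \<sigma> y \<le> radius \<tau> y"
  unfolding radius_def by (intro real_sqrt_le_mono add_left_mono power_mono)

lemma DERIV_radius_space:
  assumes "\<tau> \<noteq> 0"
  shows "(radius \<tau> has_real_derivative sin y * cos y / radius \<tau> y) (at y)"
  using radius_pos[of \<tau> y] assms unfolding radius_def
  by (auto intro!: derivative_eq_intros simp: field_simps)

lemma DERIV_radius_time:
  assumes "T - t \<noteq> 0 \<or> sin y \<noteq> 0"
  shows "((\<lambda>t. radius (T - t) y) has_real_derivative - (T - t) / radius (T - t) y) (at t within S)"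
proof -
  define q where "q = (sin y)\<^sup>2 + (T - t)\<^sup>2"
  have "sqrt q > 0"
    using radius_pos[OF assms] by (simp add: radius_def q_def)
  then show ?thesis
    unfolding radius_def
    by (auto intro!: derivative_eq_intros simp: q_def[symmetric] divide_simps)
qed

text \<open>The hypothesis admits \<open>t = T\<close> off the planes \<open>sin y = 0\<close>, so
  the fundamental theorem of calculus can be applied on the closed interval
  \<open>{0..T}\<close>.\<close>

lemma DERIV_inverse_radius_time:
  assumes "T - t \<noteq> 0 \<or> sin y \<noteq> 0"
  shows "((\<lambda>t. 1 / radius (T - t) y) has_real_derivative (T - t) / radius (T - t) y ^ 3) (at t within S)"
  by (rule DERIV_cong[OF DERIV_divide[OF DERIV_const DERIV_radius_time]])
    (use radius_pos[OF assms] assms in \<open>simp_all add: power3_eq_cube field_simps\<close>)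

lemma DERIV_velocity_profile:
  assumes "\<tau> \<noteq> 0"
  shows "((\<lambda>y. - \<tau> / radius \<tau> y) has_real_derivative shear_rate \<tau> y) (at y)"
  using radius_pos[of \<tau> y] assms unfolding shear_rate_def
  by (auto intro!: derivative_eq_intros DERIV_radius_space simp: power2_eq_square power3_eq_cube)

lemma DERIV_displacement:
  assumes "t < T" "0 < T"
  shows "((\<lambda>y. radius (T - t) y - radius T y) has_real_derivative shear_strength T t y) (at y)"
  unfolding shear_strength_def
  using assms by (auto intro!: derivative_eq_intros DERIV_radius_space simp: algebra_simps)

lemma DERIV_shear_strength:
  assumes "t < T"
  shows "((\<lambda>t. shear_strength T t y) has_real_derivative shear_rate (T - t) y) (at t within S)"
  unfolding shear_strength_def shear_rate_def
  by (rule DERIV_cong[OF DERIV_cmult[OF DERIV_diff[OF DERIV_inverse_radius_time DERIV_const]]])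
    (use assms in simp_all)

text \<open>The radius decreases in time, so the bracket lies between 0 and
  \<open>1 / radius (T - t) y\<close>, and the factor \<open>sin y\<close> is absorbed by the
  radius.\<close>

lemma abs_shear_strength_le:
  assumes "0 \<le> t" "t < T"
  shows "\<bar>shear_strength T t y\<bar> \<le> 1"
proof -
  have r: "0 < radius (T - t) y" "radius (T - t) y \<le> radius T y"
    using assms by (auto intro: radius_pos radius_mono)
  then have "0 \<le> 1 / radius (T - t) y - 1 / radius T y"
    by (simp add: frac_le)
  moreover have "1 / radius (T - t) y - 1 / radius T y \<le> 1 / radius (T - t) y"
    using r by simp
  ultimately have "\<bar>shear_strength T t y\<bar> \<le> \<bar>sin y\<bar> * \<bar>cos y\<bar> * (1 / radius (T - t) y)"
    unfolding shear_strength_def abs_mult by (intro mult_left_mono) auto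
  also have "\<dots> \<le> radius (T - t) y * 1 * (1 / radius (T - t) y)"
    using r by (intro mult_mono abs_sin_le_radius) auto
  finally show ?thesis using r by simp
qed

text \<open>For fixed \<open>y\<close> the rate has constant sign, so its time integral telescopes to a shear strength.\<close>

lemma nn_integral_shear_rate_le:
  assumes "T > 0"
  shows "(\<integral>\<^sup>+t\<in>{0..<T}. ennreal \<bar>shear_rate (T - t) y\<bar> \<partial>lborel) \<le> 1"
proof (cases "sin y = 0")
  case False
  let ?f = "\<lambda>t. \<bar>sin y * cos y\<bar> * ((T - t) / radius (T - t) y ^ 3)"
  \<comment> \<open>At \<open>t = T\<close> the radius is \<open>\<bar>sin y\<bar>\<close>, so this
    antiderivative ends at \<open>\<bar>cos y\<bar>\<close>.\<close>
  let ?F = "\<lambda>t. \<bar>sin y * cos y\<bar> * (1 / radius (T - t) y)"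
  have r: "0 < radius \<tau> y" for \<tau>
    using False by (simp add: radius_pos)
  have abs: "\<bar>shear_rate (T - t) y\<bar> = ?f t" if "t < T" for t
    using that r[of "T - t"] by (simp add: shear_rate_def abs_mult)
  have "(\<integral>\<^sup>+t\<in>{0..<T}. ennreal \<bar>shear_rate (T - t) y\<bar> \<partial>lborel) \<le>
      (\<integral>\<^sup>+t. ennreal (?f t) * indicator {0..T} t \<partial>lborel)"
    by (intro nn_integral_mono) (auto simp: abs split: split_indicator)
  also have "\<dots> = ennreal (?F T - ?F 0)"
  proof (rule nn_integral_FTC_Icc)
    show "?f \<in> borel_measurable borel"
      unfolding radius_def by measurable
    show "(?F has_real_derivative ?f t) (at t)" for t
      using False by (intro DERIV_cmult DERIV_inverse_radius_time) simp
    show "0 \<le> ?f t" if "t \<in> {0..T}" for t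
      using that r[of "T - t"] by simp
  qed (use assms in simp)
  also have "\<dots> \<le> ennreal (?F T)"
    using r[of T] by (intro ennreal_leI) simp
  also have "?F T \<le> 1"
    using False by (simp add: radius_def abs_mult)
  finally show ?thesis
    by (simp add: ennreal_leI)
qed (simp add: shear_rate_def)

text \<open>Where \<open>sin y = \<tau>\<close> the radius is \<open>sqrt 2 * \<tau>\<close>.
  Bounding \<open>sqrt 2\<close> by 3/2, its cube by 4 and the cosine below by 1/2 yields the
  constant 8.\<close>

lemma shear_rate_arcsin:
  assumes "0 < \<tau>" "\<tau> \<le> 1 / 2"
  shows "1 / (8 * \<tau>) \<le> shear_rate \<tau> (arcsin \<tau>)"
proof -
  have c: "1 / 2 \<le> cos (arcsin \<tau>)"
  proof -
    have "\<tau>\<^sup>2 \<le> (1 / 2)\<^sup>2"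
      using assms by (intro power_mono) auto
    then have "(1 / 2)\<^sup>2 \<le> 1 - \<tau>\<^sup>2"
      by (simp add: power2_eq_square)
    then have "1 / 2 \<le> sqrt (1 - \<tau>\<^sup>2)"
      by (rule real_le_rsqrt)
    then show ?thesis
      using assms by (simp add: cos_arcsin)
  qed
  have "radius \<tau> (arcsin \<tau>) \<le> 3 / 2 * \<tau>"
    unfolding radius_def using assms by (intro real_le_lsqrt) (auto simp: power2_eq_square)
  then have "radius \<tau> (arcsin \<tau>) ^ 3 \<le> (3 / 2 * \<tau>) ^ 3"
    by (intro power_mono) (auto simp: radius_def)
  also have "(3 / 2 * \<tau>) ^ 3 = 27 / 8 * \<tau> ^ 3"
    by (simp add: power3_eq_cube)
  finally have "radius \<tau> (arcsin \<tau>) ^ 3 \<le> 4 * \<tau> ^ 3"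
    using zero_less_power[OF assms(1), of 3] by linarith
  moreover have "0 < radius \<tau> (arcsin \<tau>) ^ 3"
    using assms by (simp add: radius_pos)
  moreover have "\<tau> * \<tau> * (1 / 2) \<le> \<tau> * \<tau> * cos (arcsin \<tau>)"
    using assms c by (intro mult_left_mono) auto
  ultimately have "\<tau> * \<tau> * (1 / 2) / (4 * \<tau> ^ 3) \<le> shear_rate \<tau> (arcsin \<tau>)"
    unfolding shear_rate_def using assms by (intro frac_le) auto
  then show ?thesis
    using assms by (simp add: power3_eq_cube)
qed

text \<open>Serves both the strain and the stretch rates: each dominates a fixed multiple of the
  shear rate, whose peak grows like the inverse of the remaining time.\<close>

lemma esssup_shear_rate_diverges:
  fixes f :: "real \<Rightarrow> real^3 \<Rightarrow> ennreal"
  assumes "T > 0" "k > 0"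
    and f: "\<And>t x. 0 \<le> t \<Longrightarrow> t < T \<Longrightarrow> ennreal (k * \<bar>shear_rate (T - t) (x $ 1)\<bar>) \<le> f t x"
  shows "(\<integral>\<^sup>+t\<in>{0..<T}. esssup torus_measure (f t) \<partial>lborel) = \<infinity>"
proof (rule nn_integral_inverse_distance_endpoint)
  \<comment> \<open>From this starting time on, \<open>T - t\<close> is at most 1/2, as
    \<open>shear_rate_arcsin\<close> requires.\<close>
  show "k / 8 > 0" "0 \<le> max 0 (T - 1 / 2)" "max 0 (T - 1 / 2) < T"
    using assms by auto
  fix t assume t: "max 0 (T - 1 / 2) \<le> t" "t < T"
  define \<tau> where "\<tau> = T - t"
  have \<tau>: "0 < \<tau>" "\<tau> \<le> 1 / 2"
    using t by (auto simp: \<tau>_def)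
  \<comment> \<open>The first coordinate sits at the peak; the others only have to lie strictly
    inside the cube.\<close>
  define x0 :: "real^3" where "x0 = (\<chi> i. arcsin \<tau>)"
  have "arcsin \<tau> > 0" "arcsin \<tau> \<le> pi / 2"
    using \<tau> arcsin_less_arcsin[of 0 \<tau>] arcsin_bounded[of \<tau>] by auto
  then have x0: "0 < x0 $ i \<and> x0 $ i < 2 * pi" for i
    using pi_gt_zero by (simp add: x0_def)
  have "isCont (\<lambda>y. k * \<bar>shear_rate \<tau> y\<bar>) (x0 $ 1)"
  proof -
    have "isCont (radius \<tau>) y" "radius \<tau> y ^ 3 \<noteq> 0" for y
      using \<tau>(1) radius_pos[of \<tau> y] DERIV_isCont[OF DERIV_radius_space[of \<tau> y]] by simp_all
    then show ?thesis
      unfolding shear_rate_def by (intro continuous_intros)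
  qed
  then have "continuous (at x0) (\<lambda>x. k * \<bar>shear_rate \<tau> (x $ 1)\<bar>)"
    by (rule isCont_o2[where f = "\<lambda>x. x $ 1" and g = "\<lambda>y. k * \<bar>shear_rate \<tau> y\<bar>",
          OF continuous_component[OF continuous_ident]])
  then have "ennreal (k * \<bar>shear_rate \<tau> (x0 $ 1)\<bar>) \<le> esssup torus_measure (f t)"
    using x0 f t unfolding \<tau>_def by (intro esssup_torus_ge) auto
  moreover have "k / 8 / (T - t) \<le> k * \<bar>shear_rate \<tau> (x0 $ 1)\<bar>"
    using shear_rate_arcsin[OF \<tau>] \<tau> \<open>k > 0\<close> mult_left_mono[of "1 / (8 * \<tau>)" "\<bar>shear_rate \<tau> (arcsin \<tau>)\<bar>" k]
    by (simp add: x0_def \<tau>_def)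
  ultimately show "ennreal (k / 8 / (T - t)) \<le> esssup torus_measure (f t)"
    by (meson ennreal_leI order_trans)
qed

section \<open>A differentially closed algebra containing the inverse radius\<close>

inductive_set radius_algebra :: "real \<Rightarrow> (real \<times> (real^3) \<Rightarrow> real) set" for T where
  const: "(\<lambda>p. c) \<in> radius_algebra T"
| time: "(\<lambda>p. T - fst p) \<in> radius_algebra T"
| sin: "(\<lambda>p. sin (snd p $ 1)) \<in> radius_algebra T"
| cos: "(\<lambda>p. cos (snd p $ 1)) \<in> radius_algebra T"
| inv: "(\<lambda>p. 1 / radius (T - fst p) (snd p $ 1)) \<in> radius_algebra T"
| add: "f \<in> radius_algebra T \<Longrightarrow> g \<in> radius_algebra T \<Longrightarrow> (\<lambda>p. f p + g p) \<in> radius_algebra T"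
| mult: "f \<in> radius_algebra T \<Longrightarrow> g \<in> radius_algebra T \<Longrightarrow> (\<lambda>p. f p * g p) \<in> radius_algebra T"

text \<open>The cube is written as a product and the sign as a factor \<open>- 1\<close> so that,
  for fixed \<open>v\<close>, the introduction rules of \<open>radius_algebra\<close> match term by
  term.\<close>

lemma has_derivative_inverse_radius:
  assumes "fst p < T"
  shows "((\<lambda>p :: real \<times> (real^3). 1 / radius (T - fst p) (snd p $ 1)) has_derivative
    (\<lambda>v. (1 / radius (T - fst p) (snd p $ 1)) * (1 / radius (T - fst p) (snd p $ 1)) *
      (1 / radius (T - fst p) (snd p $ 1)) *
      ((T - fst p) * fst v + (- 1) * sin (snd p $ 1) * cos (snd p $ 1) * (snd v $ 1)))) (at p within S)"
proof -
  have r: "0 < (sin (snd p $ 1))\<^sup>2 + (T - fst p)\<^sup>2"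
    using assms by (simp add: add_nonneg_pos)
  have nth: "((\<lambda>p :: real \<times> (real^3). snd p $ 1) has_derivative (\<lambda>v. snd v $ 1)) (at p within S)"
    by (intro bounded_linear_imp_has_derivative bounded_linear_compose[OF bounded_linear_vec_nth bounded_linear_snd])
  define q where "q = (sin (snd p $ 1))\<^sup>2 + (T - fst p)\<^sup>2"
  have q: "sqrt q > 0" "sqrt q * sqrt q = q"
    using r by (auto simp: q_def)
  have "((\<lambda>z. 1 / sqrt z) has_real_derivative - (1 / 2) * (1 / (sqrt q * sqrt q * sqrt q))) (at q)"
    using q by (auto intro!: derivative_eq_intros simp: divide_simps)
  moreover have "((\<lambda>p :: real \<times> (real^3). (sin (snd p $ 1))\<^sup>2 + (T - fst p)\<^sup>2) has_derivative
      (\<lambda>v. 2 * sin (snd p $ 1) * cos (snd p $ 1) * (snd v $ 1) - 2 * (T - fst p) * fst v)) (at p within S)"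
    by (auto intro!: derivative_eq_intros nth simp: fun_eq_iff algebra_simps)
  ultimately have "((\<lambda>p :: real \<times> (real^3). 1 / sqrt ((sin (snd p $ 1))\<^sup>2 + (T - fst p)\<^sup>2)) has_derivative
      (\<lambda>v. (2 * sin (snd p $ 1) * cos (snd p $ 1) * (snd v $ 1) - 2 * (T - fst p) * fst v) *
        (- (1 / 2) * (1 / (sqrt q * sqrt q * sqrt q))))) (at p within S)"
    unfolding q_def by (intro DERIV_compose_FDERIV)
  then show ?thesis
    unfolding radius_def q_def[symmetric]
    by (rule has_derivative_eq_rhs) (use q(1) in \<open>simp add: fun_eq_iff divide_simps algebra_simps\<close>)
qed

text \<open>Differentiating a generator in a fixed direction gives a polynomial in the generators:
  the components of \<open>v\<close> are constants, and the inverse radius yields only its own cube.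
  Sum and product rules do the rest.\<close>

lemma radius_algebra_derivative:
  fixes T :: real
  defines "S \<equiv> {0..<T} \<times> (UNIV :: (real^3) set)"
  assumes "f \<in> radius_algebra T"
  shows "\<exists>D. (\<forall>p\<in>S. (f has_derivative D p) (at p within S)) \<and> (\<forall>v. (\<lambda>p. D p v) \<in> radius_algebra T)"
  using assms(2)
proof induction
  have nth: "((\<lambda>p :: real \<times> (real^3). snd p $ 1) has_derivative (\<lambda>v. snd v $ 1)) (at p within S)" for p
    by (intro bounded_linear_imp_has_derivative bounded_linear_compose[OF bounded_linear_vec_nth bounded_linear_snd])
  note intros = radius_algebra.intros
  {
    case (const c)
    show ?case
      by (intro exI[of _ "\<lambda>p v. 0"]) (auto intro: intros)
  next
    case time
    show ?case
      by (intro exI[of _ "\<lambda>p v. - fst v"]) (auto intro!: intros derivative_eq_intros)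
  next
    case sin
    show ?case
      by (intro exI[of _ "\<lambda>p v. cos (snd p $ 1) * (snd v $ 1)"])
        (auto intro!: intros derivative_eq_intros nth)
  next
    case cos
    show ?case
      by (intro exI[of _ "\<lambda>p v. (- (snd v $ 1)) * sin (snd p $ 1)"] conjI ballI allI intros)
        (auto intro!: derivative_eq_intros nth)
  next
    case inv
    show ?case
      by (rule exI, rule conjI, rule ballI, rule has_derivative_inverse_radius)
        (simp add: S_def mem_Times_iff, intro allI intros)
  next
    case (add f g)
    then obtain D E where
      "\<forall>p\<in>S. (f has_derivative D p) (at p within S)" "\<forall>v. (\<lambda>p. D p v) \<in> radius_algebra T"
      "\<forall>p\<in>S. (g has_derivative E p) (at p within S)" "\<forall>v. (\<lambda>p. E p v) \<in> radius_algebra T"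
      by blast
    then show ?case
      by (intro exI[of _ "\<lambda>p v. D p v + E p v"]) (auto intro!: intros has_derivative_add)
  next
    case (mult f g)
    then obtain D E where
      "\<forall>p\<in>S. (f has_derivative D p) (at p within S)" "\<forall>v. (\<lambda>p. D p v) \<in> radius_algebra T"
      "\<forall>p\<in>S. (g has_derivative E p) (at p within S)" "\<forall>v. (\<lambda>p. E p v) \<in> radius_algebra T"
      by blast
    with mult.hyps show ?case
      by (intro exI[of _ "\<lambda>p v. f p * E p v + D p v * g p"]) (auto intro!: intros has_derivative_mult)
  }
qed

section \<open>The velocity field, its explicit flow and the stretch rates\<close>

definition velocity :: "real \<Rightarrow> real \<Rightarrow> real^3 \<Rightarrow> real^3" where
  "velocity T t x = (- (T - t) / radius (T - t) (x $ 1)) *\<^sub>R axis 2 1"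

definition flow :: "real \<Rightarrow> real^3 \<Rightarrow> real \<Rightarrow> real^3" where
  "flow T a t = a + (radius (T - t) (a $ 1) - radius T (a $ 1)) *\<^sub>R axis 2 1"

lemma smooth_velocity: "smooth_field_on_torus T (velocity T)"
  unfolding smooth_field_on_torus_def
proof (intro conjI ballI)
  let ?S = "{0..<T} \<times> (UNIV :: (real^3) set)"
  \<comment> \<open>Lifts the scalar class to fields along the second axis; differentiation acts on
    the coefficient.\<close>
  let ?A = "{\<lambda>p. f p *\<^sub>R axis 2 (1 :: real) :: real^3 | f. f \<in> radius_algebra T}"
  show "Cinf_on ?S (\<lambda>(t, x). velocity T t x)"
  proof (rule Cinf_on_slabI)
    have "(\<lambda>p. (- 1) * (T - fst p) * (1 / radius (T - fst p) (snd p $ 1))) \<in> radius_algebra T"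
      by (intro radius_algebra.intros)
    moreover have "(\<lambda>(t, x). velocity T t x) =
        (\<lambda>p. ((- 1) * (T - fst p) * (1 / radius (T - fst p) (snd p $ 1))) *\<^sub>R axis 2 1)"
      by (simp add: velocity_def fun_eq_iff)
    ultimately show "(\<lambda>(t, x). velocity T t x) \<in> ?A"
      by (intro CollectI exI[of _ "\<lambda>p. (- 1) * (T - fst p) * (1 / radius (T - fst p) (snd p $ 1))"] conjI)
  next
    fix F assume "F \<in> ?A"
    then obtain f where F: "F = (\<lambda>p. f p *\<^sub>R axis 2 1)" and f: "f \<in> radius_algebra T"
      by blast
    obtain D where D: "\<forall>p\<in>?S. (f has_derivative D p) (at p within ?S)"
        "\<forall>v. (\<lambda>p. D p v) \<in> radius_algebra T"
      using radius_algebra_derivative[OF f] by blast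
    show "\<exists>D. (\<forall>p\<in>?S. (F has_derivative D p) (at p within ?S)) \<and> (\<forall>v. (\<lambda>p. D p v) \<in> ?A)"
    proof (intro exI conjI ballI allI)
      show "(F has_derivative (\<lambda>v. D p v *\<^sub>R axis 2 1)) (at p within ?S)" if "p \<in> ?S" for p
        unfolding F using D(1) that by (intro has_derivative_scaleR_left) blast
      show "(\<lambda>p. D p v *\<^sub>R axis 2 1) \<in> ?A" for v
        using D(2) by (intro CollectI exI[of _ "\<lambda>p. D p v"] conjI refl) (rule spec)
    qed
  qed
  fix t
  show "torus_periodic (velocity T t)"
    unfolding torus_periodic_def
  proof (intro allI)
    fix x :: "real^3" and i :: 3
    show "velocity T t (x + axis i (2 * pi)) = velocity T t x"
      by (cases "i = 1") (auto simp: velocity_def radius_def axis_def)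
  qed
qed

lemma lagrangian_flow_velocity: "lagrangian_flow T (velocity T) (flow T)"
  unfolding lagrangian_flow_def
proof (intro conjI ballI allI)
  show "flow T a 0 = a" for a
    by (simp add: flow_def)
  fix t assume "t \<in> {0..<T}"
  then have t: "t < T" by simp
  \<comment> \<open>The velocity depends only on the first coordinate, which the flow fixes, so the
    equation reduces to the time derivative of the radius at fixed \<open>a $ 1\<close>.\<close>
  show "(flow T a has_vector_derivative velocity T t (flow T a t)) (at t within {0..<T})" for a
    unfolding flow_def velocity_def using t
    by (auto intro!: derivative_eq_intros DERIV_radius_time
        simp: axis_def has_real_derivative_iff_has_vector_derivative[symmetric])
  show "torus_equivariant (\<lambda>a. flow T a t)"
    unfolding flow_def by (rule torus_equivariant_shear) (simp add: radius_def)
qed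

lemma deformation_gradient_flow:
  assumes "0 < T" "t < T"
  shows "deformation_gradient (flow T) a t = mat 1 + shear_gradient (shear_strength T t (a $ 1))"
  unfolding deformation_gradient_def flow_def
  by (rule jacobian_shear) (rule DERIV_displacement[OF assms(2,1)])

lemma log_stretch_flow:
  assumes "t \<in> {0..<T}" "d \<noteq> 0"
  shows "(log_stretch (flow T) d a has_real_derivative
    shear_rate (T - t) (a $ 1) * stretch_factor d (shear_strength T t (a $ 1))) (at t within {0..<T})"
  unfolding has_field_derivative_def
\<comment> \<open>The formula for the deformation gradient is available for \<open>t < T\<close>;
  agreement on \<open>{0..<T}\<close> suffices for the derivative within that set.\<close>
proof (rule has_derivative_transform[OF assms(1)])
  show "((\<lambda>t. ln (norm ((mat 1 + shear_gradient (shear_strength T t (a $ 1))) *v d))) has_derivative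
    (*) (shear_rate (T - t) (a $ 1) * stretch_factor d (shear_strength T t (a $ 1)))) (at t within {0..<T})"
    using assms unfolding has_field_derivative_def[symmetric]
    by (intro has_derivative_log_norm_shear DERIV_shear_strength) auto
qed (use assms in \<open>simp add: log_stretch_def deformation_gradient_flow\<close>)

lemma stretch_rate_flow:
  assumes "t \<in> {0..<T}" "d \<noteq> 0"
  shows "stretch_rate T (flow T) d a t =
    shear_rate (T - t) (a $ 1) * stretch_factor d (shear_strength T t (a $ 1))"
  unfolding stretch_rate_def
proof (rule vector_derivative_within)
  \<comment> \<open>Makes the one-sided derivative unique, also at time 0.\<close>
  show "at t within {0..<T} \<noteq> bot"
    using assms(1) by (simp add: trivial_limit_within islimpt_Ico)
qed (use log_stretch_flow[OF assms] in \<open>simp add: has_real_derivative_iff_has_vector_derivative\<close>)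

section \<open>Time integrals along particles, and the theorem\<close>

lemma SUP_nn_integral_shear_rate:
  fixes f :: "real^3 \<Rightarrow> real \<Rightarrow> ennreal"
  assumes "T > 0" "k \<ge> 0"
    and f: "\<And>a t. 0 \<le> t \<Longrightarrow> t < T \<Longrightarrow> f a t \<le> ennreal (k * \<bar>shear_rate (T - t) (a $ 1)\<bar>)"
  shows "(SUP a. \<integral>\<^sup>+t\<in>{0..<T}. f a t \<partial>lborel) < \<infinity>"
proof -
  \<comment> \<open>The bound \<open>k\<close> is independent of the particle, so it survives the
    supremum.\<close>
  have "(\<integral>\<^sup>+t\<in>{0..<T}. f a t \<partial>lborel) \<le> ennreal k" for a
  proof -
    have "(\<integral>\<^sup>+t\<in>{0..<T}. f a t \<partial>lborel) \<le>
        (\<integral>\<^sup>+t. ennreal k * (ennreal \<bar>shear_rate (T - t) (a $ 1)\<bar> * indicator {0..<T} t) \<partial>lborel)"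
      using f \<open>k \<ge> 0\<close> by (intro nn_integral_mono) (auto simp: ennreal_mult split: split_indicator)
    also have "\<dots> = ennreal k * (\<integral>\<^sup>+t\<in>{0..<T}. ennreal \<bar>shear_rate (T - t) (a $ 1)\<bar> \<partial>lborel)"
      by (rule nn_integral_cmult) (simp add: shear_rate_def radius_def)
    also have "\<dots> \<le> ennreal k * 1"
      by (intro mult_left_mono nn_integral_shear_rate_le \<open>T > 0\<close>) simp
    finally show ?thesis by simp
  qed
  then have "(SUP a. \<integral>\<^sup>+t\<in>{0..<T}. f a t \<partial>lborel) \<le> ennreal k"
    by (rule SUP_least)
  then show ?thesis
    by (simp add: le_less_trans)
qed

theorem theorem6p4:
  fixes T :: real
  assumes "T > 0"
  shows "\<exists>(u :: real \<Rightarrow> real^3 \<Rightarrow> real^3) (X :: real^3 \<Rightarrow> real \<Rightarrow> real^3).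
    smooth_field_on_torus T u \<and>
    (\<forall>t\<in>{0..<T}. \<forall>x. divergence (u t) x = 0) \<and>
    lagrangian_flow T u X \<and>
    (\<forall>t\<in>{0..<T}. volume_preserving (\<lambda>a. X a t)) \<and>
    (\<forall>t\<in>{0..<T}. \<forall>a. (\<lambda>b. X b t) differentiable (at a)) \<and>
    (\<forall>d\<in>sphere 0 1. \<forall>a. \<forall>t\<in>{0..<T}.
       deformation_gradient X a t *v d \<noteq> 0 \<and>
       log_stretch X d a differentiable (at t within {0..<T})) \<and>
    (\<integral>\<^sup>+t\<in>{0..<T}. esssup torus_measure (\<lambda>x. ennreal (norm (strain (u t) x))) \<partial>lborel) = \<infinity> \<and>
    (SUP a. \<integral>\<^sup>+t\<in>{0..<T}. ennreal (norm (strain (u t) (X a t))) \<partial>lborel) < \<infinity> \<and>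
    (\<forall>D. direction_system D \<and> D \<noteq> {} \<longrightarrow>
       (SUP a. \<integral>\<^sup>+t\<in>{0..<T}. ennreal (MAX d\<in>D. \<bar>stretch_rate T X d a t\<bar>) \<partial>lborel) < \<infinity>) \<and>
    (\<forall>D. robust D \<longrightarrow>
       (\<integral>\<^sup>+t\<in>{0..<T}. esssup torus_measure
            (\<lambda>a. ennreal (sqrt (\<Sum>d\<in>D. (stretch_rate T X d a t)\<^sup>2))) \<partial>lborel) = \<infinity> \<and>
       (SUP a. \<integral>\<^sup>+t\<in>{0..<T}. ennreal (sqrt (\<Sum>d\<in>D. (stretch_rate T X d a t)\<^sup>2)) \<partial>lborel) < \<infinity>)"
proof (intro exI[of _ "velocity T"] exI[of _ "flow T"] conjI ballI allI impI)
  show "smooth_field_on_torus T (velocity T)"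
    by (rule smooth_velocity)
  show "lagrangian_flow T (velocity T) (flow T)"
    by (rule lagrangian_flow_velocity)
  show "divergence (velocity T t) x = 0" if "t \<in> {0..<T}" for t x
    unfolding velocity_def
    by (rule divergence_shear, rule DERIV_velocity_profile) (use that in simp)
  show "volume_preserving (\<lambda>a. flow T a t)" if "t \<in> {0..<T}" for t
    unfolding flow_def
    by (rule volume_preserving_shear, rule DERIV_displacement) (use that assms in auto)
  show "(\<lambda>b. flow T b t) differentiable (at a)" if "t \<in> {0..<T}" for t a
    unfolding flow_def differentiable_def
    by (rule exI, rule has_derivative_shear, rule DERIV_displacement) (use that assms in auto)
  have strain: "\<bar>shear_rate (T - t) (x $ 1)\<bar> / 2 \<le> norm (strain (velocity T t) x)"
      "norm (strain (velocity T t) x) \<le> \<bar>shear_rate (T - t) (x $ 1)\<bar>" if "t < T" for t x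
    unfolding velocity_def
    by (rule shear_strain_bounds[OF DERIV_velocity_profile], use that in simp)+
  show "(\<integral>\<^sup>+t\<in>{0..<T}. esssup torus_measure (\<lambda>x. ennreal (norm (strain (velocity T t) x))) \<partial>lborel) = \<infinity>"
    by (rule esssup_shear_rate_diverges[where k = "1 / 2"])
      (use assms strain in \<open>auto intro!: ennreal_leI\<close>)
  show "(SUP a. \<integral>\<^sup>+t\<in>{0..<T}. ennreal (norm (strain (velocity T t) (flow T a t))) \<partial>lborel) < \<infinity>"
  \<comment> \<open>The strain at the particle's position is controlled by the shear rate at its
    label, since \<open>flow\<close> keeps the first coordinate.\<close>
  proof (rule SUP_nn_integral_shear_rate[where k = 1])
    show "ennreal (norm (strain (velocity T t) (flow T a t))) \<le> ennreal (1 * \<bar>shear_rate (T - t) (a $ 1)\<bar>)"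
      if "t < T" for a t
      using strain(2)[OF that, of "flow T a t"] by (simp add: flow_def axis_def ennreal_leI)
  qed (use assms in auto)
  show "deformation_gradient (flow T) a t *v d \<noteq> 0"
      "log_stretch (flow T) d a differentiable (at t within {0..<T})"
    if "d \<in> sphere 0 1" "t \<in> {0..<T}" for d a t
  proof -
    have "d \<noteq> 0" using that by auto
    then show "deformation_gradient (flow T) a t *v d \<noteq> 0"
      using that by (simp add: deformation_gradient_flow shear_mult_nonzero)
    show "log_stretch (flow T) d a differentiable (at t within {0..<T})"
      using log_stretch_flow[OF that(2) \<open>d \<noteq> 0\<close>]
      by (auto simp: has_field_derivative_def differentiable_def)
  qed
  have rate_le: "\<bar>stretch_rate T (flow T) d a t\<bar> \<le> \<bar>shear_rate (T - t) (a $ 1)\<bar>"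
    if "d \<noteq> 0" "0 \<le> t" "t < T" for d a t
    using that mult_left_mono[OF abs_stretch_factor_le, of "\<bar>shear_rate (T - t) (a $ 1)\<bar>"]
    by (simp add: stretch_rate_flow abs_mult)
  show "(SUP a. \<integral>\<^sup>+t\<in>{0..<T}. ennreal (MAX d\<in>D. \<bar>stretch_rate T (flow T) d a t\<bar>) \<partial>lborel) < \<infinity>"
    if "direction_system D \<and> D \<noteq> {}" for D
  proof (rule SUP_nn_integral_shear_rate[where k = 1])
    have "finite D" "D \<noteq> {}" "\<And>d. d \<in> D \<Longrightarrow> d \<noteq> 0"
      using that by (auto simp: direction_system_def)
    then show "ennreal (MAX d\<in>D. \<bar>stretch_rate T (flow T) d a t\<bar>) \<le> ennreal (1 * \<bar>shear_rate (T - t) (a $ 1)\<bar>)"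
      if "0 \<le> t" "t < T" for a t
      using that by (intro ennreal_leI) (auto simp: rate_le)
  qed (use assms in auto)
  fix D assume D: "robust D"
  then have fin: "finite D" and nz: "\<And>d. d \<in> D \<Longrightarrow> d \<noteq> 0"
    by (auto simp: robust_def direction_system_def)
  show "(SUP a. \<integral>\<^sup>+t\<in>{0..<T}. ennreal (sqrt (\<Sum>d\<in>D. (stretch_rate T (flow T) d a t)\<^sup>2)) \<partial>lborel) < \<infinity>"
  \<comment> \<open>The Euclidean norm is at most the sum of absolute values, one shear rate per
    direction.\<close>
  proof (rule SUP_nn_integral_shear_rate[where k = "real (card D)"])
    fix a t assume t: "0 \<le> t" "t < T"
    have "sqrt (\<Sum>d\<in>D. (stretch_rate T (flow T) d a t)\<^sup>2) \<le> (\<Sum>d\<in>D. \<bar>stretch_rate T (flow T) d a t\<bar>)"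
      using L2_set_le_sum_abs by (simp add: L2_set_def)
    also have "\<dots> \<le> real (card D) * \<bar>shear_rate (T - t) (a $ 1)\<bar>"
      using t nz by (intro sum_bounded_above rate_le)
    finally show "ennreal (sqrt (\<Sum>d\<in>D. (stretch_rate T (flow T) d a t)\<^sup>2)) \<le>
        ennreal (real (card D) * \<bar>shear_rate (T - t) (a $ 1)\<bar>)"
      by (rule ennreal_leI)
  qed (use assms in auto)
  obtain c where c: "c > 0" "\<And>p. p \<in> {-1..1} \<Longrightarrow> c \<le> (\<Sum>d\<in>D. (stretch_factor d p)\<^sup>2)"
    using robust_stretch_factor_bound[OF D] by blast
  show "(\<integral>\<^sup>+t\<in>{0..<T}. esssup torus_measure
            (\<lambda>a. ennreal (sqrt (\<Sum>d\<in>D. (stretch_rate T (flow T) d a t)\<^sup>2))) \<partial>lborel) = \<infinity>"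
  \<comment> \<open>The shear rate factors out of all stretch rates; the remaining sum of squares is
    at least \<open>c\<close> because the shear strength stays in \<open>{-1..1}\<close>.\<close>
  proof (rule esssup_shear_rate_diverges[where k = "sqrt c"])
    fix t and a :: "real^3" assume t: "0 \<le> t" "t < T"
    let ?s = "shear_rate (T - t) (a $ 1)" and ?p = "shear_strength T t (a $ 1)"
    have "sqrt c * \<bar>?s\<bar> = sqrt (?s\<^sup>2 * c)"
      by (simp add: real_sqrt_mult)
    also have "\<dots> \<le> sqrt (?s\<^sup>2 * (\<Sum>d\<in>D. (stretch_factor d ?p)\<^sup>2))"
      using abs_shear_strength_le[OF t, of "a $ 1"]
      by (intro real_sqrt_le_mono mult_left_mono c) (auto simp: abs_le_iff)
    also have "\<dots> = sqrt (\<Sum>d\<in>D. (stretch_rate T (flow T) d a t)\<^sup>2)"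
      using t nz by (simp add: stretch_rate_flow power_mult_distrib sum_distrib_left)
    finally show "ennreal (sqrt c * \<bar>?s\<bar>) \<le> ennreal (sqrt (\<Sum>d\<in>D. (stretch_rate T (flow T) d a t)\<^sup>2))"
      by (rule ennreal_leI)
  qed (use assms c in auto)
qed

end
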